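(* For $i\in\mathbb{N}$ let $A^{\uparrow\downarrow}_i=x\otimes(-t)^i$, $B^{\uparrow\downarrow}_i=(-y\otimes t-z\otimes(t-1))(-t)^i$, $\psi^{\uparrow\downarrow}_{i+1}=(x\otimes1-z\otimes(t-1))(-t)^i$; these elements form a basis, denoted $[3012]$, of the Onsager Lie algebra $O$. The basis $[3012]$ is recursively obtained in the order $$A^{\uparrow\downarrow}_0,\ B^{\uparrow\downarrow}_0,\ \psi^{\uparrow\downarrow}_1,\ A^{\uparrow\downarrow}_1,\ B^{\uparrow\downarrow}_1,\ \psi^{\uparrow\downarrow}_2,\ A^{\uparrow\downarrow}_2,\ B^{\uparrow\downarrow}_2,\ \psi^{\uparrow\downarrow}_3,\ \ldots$$ using $A^{\uparrow\downarrow}_0=A$, $B^{\uparrow\downarrow}_0=-B$ and the following equations for $i\geq1$: $$\begin{aligned} \psi^{\uparrow\downarrow}_i&=\frac{A^{\uparrow\downarrow}_{i-1}}{2}+\frac{B^{\uparrow\downarrow}_{i-1}}{2}+\frac{[A^{\uparrow\downarrow}_{i-1},B]}{4},\\ A^{\uparrow\downarrow}_i&=\frac{[\psi^{\uparrow\downarrow}_i,A]}{2}-\psi^{\uparrow\downarrow}_i,\\ B^{\uparrow\downarrow}_i&=-\frac{[B,\psi^{\uparrow\downarrow}_i]}{2}-\psi^{\uparrow\downarrow}_i. \end{aligned}$$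
   Context: $\mathbb{F}$ is a field of characteristic zero; $\mathbb{N}=\{0,1,2,\ldots\}$; tensor products are over $\mathbb{F}$. $\mathfrak{sl}_2$ is the Lie algebra over $\mathbb{F}$ with basis $e,f,h$ and $[h,e]=2e$, $[h,f]=-2f$, $[e,f]=h$. Its equitable basis is $x=2e-h$, $y=-2f-h$, $z=h$, which satisfies $[x,y]=2x+2y$, $[y,z]=2y+2z$, $[z,x]=2z+2x$. Let $t$ be an indeterminate and $\mathcal{A}=\mathbb{F}[t,t^{-1},(t-1)^{-1}]$. The three-point $\mathfrak{sl}_2$ loop algebra $L(\mathfrak{sl}_2)^+$ is the vector space $\mathfrak{sl}_2\otimes\mathcal{A}$ with Lie bracket $[u\otimes a,v\otimes b]=[u,v]\otimes ab$. It is a right $\mathcal{A}$-module via $(u\otimes a)b=u\otimes ab$. The Onsager Lie algebra $O$ (generators $A,B$; relations $[A,[A,[A,B]]]=4[A,B]$, $[B,[B,[B,A]]]=4[B,A]$) is identified with the Lie subalgebra of $L(\mathfrak{sl}_2)^+$ generated by $A=x\otimes1$ and $B=y\otimes t+z\otimes(t-1)$. *)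

theory Defs
  imports "HOL-Computational_Algebra.Computational_Algebra" "HOL.Hull"
begin

section \<open>The algebra of Laurent polynomials in t and t - 1\<close>

text \<open>
  The algebra \<open>F[t, 1/t, 1/(t-1)]\<close>, realised inside the field \<open>F(t)\<close> of rational
  functions.
\<close>

typedef (overloaded) ('a::field) three_point =
  "{r :: 'a poly fract. \<exists>p m n. r = Fract p ([:0, 1:] ^ m * [:-1, 1:] ^ n)}"
  morphisms rat_of_tp Abs_tp
  by blast

setup_lifting type_definition_three_point

lemma tp_denom_nz: "([:0, 1:] ^ m * [:-1, 1:] ^ n :: 'a::field poly) \<noteq> 0"
  by simp

instantiation three_point :: (field) comm_ring_1
begin

lift_definition zero_three_point :: "'a three_point" is 0
  by (auto simp: Zero_fract_def intro!: exI[of _ 0])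

lift_definition one_three_point :: "'a three_point" is 1
  by (rule exI[of _ 1], rule exI[of _ 0], rule exI[of _ 0], simp add: One_fract_def)

lift_definition uminus_three_point :: "'a three_point \<Rightarrow> 'a three_point" is uminus
  by (metis minus_fract)

lift_definition plus_three_point :: "'a three_point \<Rightarrow> 'a three_point \<Rightarrow> 'a three_point"
  is plus
proof -
  fix r s :: "'a poly fract"
  assume "\<exists>p m n. r = Fract p ([:0, 1:] ^ m * [:-1, 1:] ^ n)"
    and "\<exists>p m n. s = Fract p ([:0, 1:] ^ m * [:-1, 1:] ^ n)"
  then obtain p m n q k l where
    r: "r = Fract p ([:0, 1:] ^ m * [:-1, 1:] ^ n)" and
    s: "s = Fract q ([:0, 1:] ^ k * [:-1, 1:] ^ l)" by blast
  have "r + s = Fract (p * ([:0, 1:] ^ k * [:-1, 1:] ^ l) + q * ([:0, 1:] ^ m * [:-1, 1:] ^ n))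
    (([:0, 1:] ^ m * [:-1, 1:] ^ n) * ([:0, 1:] ^ k * [:-1, 1:] ^ l))"
    unfolding r s by (rule add_fract) (rule tp_denom_nz)+
  also have "([:0, 1:] ^ m * [:-1, 1:] ^ n) * ([:0, 1:] ^ k * [:-1, 1:] ^ l) =
    ([:0, 1:] ^ (m + k) * [:-1, 1:] ^ (n + l) :: 'a poly)"
    by (simp only: power_add mult_ac)
  finally show "\<exists>p m n. r + s = Fract p ([:0, 1:] ^ m * [:-1, 1:] ^ n)" by blast
qed

lift_definition minus_three_point :: "'a three_point \<Rightarrow> 'a three_point \<Rightarrow> 'a three_point"
  is minus
proof -
  fix r s :: "'a poly fract"
  assume "\<exists>p m n. r = Fract p ([:0, 1:] ^ m * [:-1, 1:] ^ n)"
    and "\<exists>p m n. s = Fract p ([:0, 1:] ^ m * [:-1, 1:] ^ n)"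
  then obtain p m n q k l where
    r: "r = Fract p ([:0, 1:] ^ m * [:-1, 1:] ^ n)" and
    s: "s = Fract q ([:0, 1:] ^ k * [:-1, 1:] ^ l)" by blast
  have "r - s = Fract (p * ([:0, 1:] ^ k * [:-1, 1:] ^ l) - q * ([:0, 1:] ^ m * [:-1, 1:] ^ n))
    (([:0, 1:] ^ m * [:-1, 1:] ^ n) * ([:0, 1:] ^ k * [:-1, 1:] ^ l))"
    unfolding r s by (rule diff_fract) (rule tp_denom_nz)+
  also have "([:0, 1:] ^ m * [:-1, 1:] ^ n) * ([:0, 1:] ^ k * [:-1, 1:] ^ l) =
    ([:0, 1:] ^ (m + k) * [:-1, 1:] ^ (n + l) :: 'a poly)"
    by (simp only: power_add mult_ac)
  finally show "\<exists>p m n. r - s = Fract p ([:0, 1:] ^ m * [:-1, 1:] ^ n)" by blast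
qed

lift_definition times_three_point :: "'a three_point \<Rightarrow> 'a three_point \<Rightarrow> 'a three_point"
  is times
proof -
  fix r s :: "'a poly fract"
  assume "\<exists>p m n. r = Fract p ([:0, 1:] ^ m * [:-1, 1:] ^ n)"
    and "\<exists>p m n. s = Fract p ([:0, 1:] ^ m * [:-1, 1:] ^ n)"
  then obtain p m n q k l where
    r: "r = Fract p ([:0, 1:] ^ m * [:-1, 1:] ^ n)" and
    s: "s = Fract q ([:0, 1:] ^ k * [:-1, 1:] ^ l)" by blast
  have "r * s = Fract (p * q)
    (([:0, 1:] ^ m * [:-1, 1:] ^ n) * ([:0, 1:] ^ k * [:-1, 1:] ^ l))"
    unfolding r s by (rule mult_fract)
  also have "([:0, 1:] ^ m * [:-1, 1:] ^ n) * ([:0, 1:] ^ k * [:-1, 1:] ^ l) =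
    ([:0, 1:] ^ (m + k) * [:-1, 1:] ^ (n + l) :: 'a poly)"
    by (simp only: power_add mult_ac)
  finally show "\<exists>p m n. r * s = Fract p ([:0, 1:] ^ m * [:-1, 1:] ^ n)" by blast
qed

instance
  by standard (transfer; simp add: algebra_simps)+

end

lift_definition tp_const :: "'a::field \<Rightarrow> 'a three_point" is "\<lambda>c. Fract [:c:] 1"
  subgoal for c by (rule exI[of _ "[:c:]"], rule exI[of _ 0], rule exI[of _ 0], simp)
  done

lift_definition tp_t :: "('a::field) three_point" is "Fract [:0, 1:] 1"
  by (rule exI[of _ "[:0, 1:]"], rule exI[of _ 0], rule exI[of _ 0], simp)

lemma tp_t_dvd_1: "(tp_t :: 'a::field three_point) dvd 1"
proof -
  define s :: "'a poly fract" where "s = Fract 1 [:0, 1:]"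
  have "\<exists>p m n. s = Fract p ([:0, 1:] ^ m * [:-1, 1:] ^ n)"
    by (rule exI[of _ 1], rule exI[of _ 1], rule exI[of _ 0]) (simp add: s_def)
  then have "rat_of_tp (Abs_tp s) = s" by (simp add: Abs_tp_inverse)
  then have "rat_of_tp (1 :: 'a three_point) = rat_of_tp (tp_t * Abs_tp s)"
    by (simp add: one_three_point.rep_eq times_three_point.rep_eq tp_t.rep_eq s_def
        One_fract_def eq_fract)
  then show ?thesis by (metis dvd_def rat_of_tp_inject)
qed

lemma tp_t_minus_1_dvd_1: "(tp_t - 1 :: 'a::field three_point) dvd 1"
proof -
  define s :: "'a poly fract" where "s = Fract 1 [:-1, 1:]"
  have "\<exists>p m n. s = Fract p ([:0, 1:] ^ m * [:-1, 1:] ^ n)"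
    by (rule exI[of _ 1], rule exI[of _ 0], rule exI[of _ 1]) (simp add: s_def)
  then have "rat_of_tp (Abs_tp s) = s" by (simp add: Abs_tp_inverse)
  then have "rat_of_tp (1 :: 'a three_point) = rat_of_tp ((tp_t - 1) * Abs_tp s)"
    by (simp add: one_three_point.rep_eq times_three_point.rep_eq minus_three_point.rep_eq
        tp_t.rep_eq s_def One_fract_def eq_fract one_pCons)
  then show ?thesis by (metis dvd_def rat_of_tp_inject)
qed

lemma tp_const_simps:
  "tp_const 0 = 0" "tp_const 1 = 1" "tp_const (c + d) = tp_const c + tp_const d"
  "tp_const (c * d) = tp_const c * tp_const d" "tp_const (- c) = - tp_const c"
  "tp_const (c - d) = tp_const c - tp_const d"
  by (transfer; simp add: Zero_fract_def One_fract_def pCons_one)+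


section \<open>The Lie algebra sl2 over a commutative ring\<close>

text \<open>\<open>SL2 a b c\<close> is the element \<open>a e + b f + c h\<close>.\<close>

datatype 'a sl2 = SL2 (e_coeff: 'a) (f_coeff: 'a) (h_coeff: 'a)

instantiation sl2 :: (comm_ring_1) ab_group_add
begin

definition "0 = SL2 0 0 0"
definition "u + v = SL2 (e_coeff u + e_coeff v) (f_coeff u + f_coeff v) (h_coeff u + h_coeff v)"
definition "- u = SL2 (- e_coeff u) (- f_coeff u) (- h_coeff u)"
definition "u - v = SL2 (e_coeff u - e_coeff v) (f_coeff u - f_coeff v) (h_coeff u - h_coeff v)"

instance
  by standard
    (simp_all add: zero_sl2_def plus_sl2_def uminus_sl2_def minus_sl2_def sl2.expand)

end

definition sl2_scale :: "'a::comm_ring_1 \<Rightarrow> 'a sl2 \<Rightarrow> 'a sl2" where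
  "sl2_scale c u = SL2 (c * e_coeff u) (c * f_coeff u) (c * h_coeff u)"

text \<open>The bilinear extension of \<open>[h,e] = 2e\<close>, \<open>[h,f] = -2f\<close>, \<open>[e,f] = h\<close>.\<close>

definition lie_bracket :: "'a::comm_ring_1 sl2 \<Rightarrow> 'a sl2 \<Rightarrow> 'a sl2" where
  "lie_bracket u v = SL2
     (2 * (h_coeff u * e_coeff v - e_coeff u * h_coeff v))
     (- 2 * (h_coeff u * f_coeff v - f_coeff u * h_coeff v))
     (e_coeff u * f_coeff v - f_coeff u * e_coeff v)"

definition sl2_e :: "'a::comm_ring_1 sl2" where "sl2_e = SL2 1 0 0"
definition sl2_f :: "'a::comm_ring_1 sl2" where "sl2_f = SL2 0 1 0"
definition sl2_h :: "'a::comm_ring_1 sl2" where "sl2_h = SL2 0 0 1"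

definition sl2_x :: "'a::comm_ring_1 sl2" where "sl2_x = sl2_scale 2 sl2_e - sl2_h"
definition sl2_y :: "'a::comm_ring_1 sl2" where "sl2_y = - sl2_scale 2 sl2_f - sl2_h"
definition sl2_z :: "'a::comm_ring_1 sl2" where "sl2_z = sl2_h"

lemmas sl2_op_defs = zero_sl2_def plus_sl2_def uminus_sl2_def minus_sl2_def
  sl2_scale_def lie_bracket_def

lemmas sl2_elem_defs = sl2_e_def sl2_f_def sl2_h_def sl2_x_def sl2_y_def sl2_z_def

lemma lie_bracket_lie_algebra:
  "lie_bracket (u + v) w = lie_bracket u w + lie_bracket v w"
  "lie_bracket w (u + v) = lie_bracket w u + lie_bracket w v"
  "lie_bracket (sl2_scale c u) v = sl2_scale c (lie_bracket u v)"
  "lie_bracket u (sl2_scale c v) = sl2_scale c (lie_bracket u v)"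
  "lie_bracket u u = 0"
  "lie_bracket u (lie_bracket v w) + lie_bracket v (lie_bracket w u)
     + lie_bracket w (lie_bracket u v) = 0"
  by (simp_all add: sl2_op_defs algebra_simps)

lemma equitable_relations:
  "lie_bracket sl2_x sl2_y = sl2_scale 2 sl2_x + sl2_scale 2 sl2_y"
  "lie_bracket sl2_y sl2_z = sl2_scale 2 sl2_y + sl2_scale 2 sl2_z"
  "lie_bracket sl2_z sl2_x = sl2_scale 2 sl2_z + sl2_scale 2 sl2_x"
  by (simp_all add: sl2_op_defs sl2_elem_defs)


section \<open>The three-point loop algebra\<close>

text \<open>
  Since \<open>sl2\<close> is free with basis \<open>e, f, h\<close>, its tensor product over \<open>F\<close> with the algebra
  above consists of the elements \<open>e \<otimes> a + f \<otimes> b + h \<otimes> c\<close>, so it is \<open>sl2\<close> with coefficients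
  in that algebra. The lemmas \<open>tensor_universal\<close> and \<open>lie_bracket_tensor\<close> below confirm
  that this is the tensor product and that its bracket is the intended one.
\<close>

type_synonym 'a loop = "'a three_point sl2"

definition tensor :: "'a::field sl2 \<Rightarrow> 'a three_point \<Rightarrow> 'a loop" (infix "\<otimes>" 75) where
  "u \<otimes> a = SL2 (tp_const (e_coeff u) * a) (tp_const (f_coeff u) * a) (tp_const (h_coeff u) * a)"

text \<open>The right module action \<open>(u \<otimes> a) b = u \<otimes> ab\<close>.\<close>

definition loop_act :: "'a::field loop \<Rightarrow> 'a three_point \<Rightarrow> 'a loop" (infixl "\<cdot>" 74) where
  "u \<cdot> b = SL2 (e_coeff u * b) (f_coeff u * b) (h_coeff u * b)"

definition loop_scale :: "'a::field \<Rightarrow> 'a loop \<Rightarrow> 'a loop" (infixr "*\<^sub>L" 75) where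
  "c *\<^sub>L u = u \<cdot> tp_const c"

interpretation loop: vector_space "loop_scale :: 'a::field \<Rightarrow> 'a loop \<Rightarrow> 'a loop"
  by standard (simp_all add: loop_scale_def loop_act_def plus_sl2_def tp_const_simps
      algebra_simps sl2.expand)

lemma tensor_act: "(u \<otimes> a) \<cdot> b = u \<otimes> (a * b)"
  by (simp add: tensor_def loop_act_def algebra_simps)

lemma lie_bracket_tensor: "lie_bracket (u \<otimes> a) (v \<otimes> b) = lie_bracket u v \<otimes> (a * b)"
proof -
  have "tp_const 2 = (2 :: 'a three_point)"
    using tp_const_simps(3)[of "1::'a" 1] by (simp add: tp_const_simps)
  then show ?thesis
    by (simp add: tensor_def lie_bracket_def tp_const_simps algebra_simps)
qed

lemma tensor_bilinear:
  "(u + v) \<otimes> a = u \<otimes> a + v \<otimes> a" "u \<otimes> (a + b) = u \<otimes> a + u \<otimes> b"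
  "sl2_scale c u \<otimes> a = c *\<^sub>L (u \<otimes> a)" "u \<otimes> (tp_const c * a) = c *\<^sub>L (u \<otimes> a)"
  by (simp_all add: tensor_def loop_scale_def loop_act_def sl2_op_defs tp_const_simps
      algebra_simps)

lemma tensor_universal:
  fixes \<phi> :: "'a::field sl2 \<Rightarrow> 'a three_point \<Rightarrow> 'w::ab_group_add"
  assumes W: "vector_space scaleW"
    and add_left: "\<And>u v a. \<phi> (u + v) a = \<phi> u a + \<phi> v a"
    and add_right: "\<And>u a b. \<phi> u (a + b) = \<phi> u a + \<phi> u b"
    and scale_left: "\<And>c u a. \<phi> (sl2_scale c u) a = scaleW c (\<phi> u a)"
    and scale_right: "\<And>c u a. \<phi> u (tp_const c * a) = scaleW c (\<phi> u a)"
  shows "\<exists>!\<Phi>. Vector_Spaces.linear loop_scale scaleW \<Phi> \<and> (\<forall>u a. \<Phi> (u \<otimes> a) = \<phi> u a)"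
proof -
  interpret W: vector_space scaleW by (rule W)
  interpret P: vector_space_pair "loop_scale :: 'a \<Rightarrow> _" scaleW ..
  have dec: "w = sl2_e \<otimes> e_coeff w + sl2_f \<otimes> f_coeff w + sl2_h \<otimes> h_coeff w" for w :: "'a loop"
    by (simp add: tensor_def sl2_elem_defs tp_const_simps plus_sl2_def)
  define \<Phi> where "\<Phi> w = \<phi> sl2_e (e_coeff w) + \<phi> sl2_f (f_coeff w) + \<phi> sl2_h (h_coeff w)" for w
  have "\<Phi> (v + w) = \<Phi> v + \<Phi> w" for v w
    by (simp add: \<Phi>_def plus_sl2_def add_right add_ac)
  moreover have "\<Phi> (c *\<^sub>L w) = scaleW c (\<Phi> w)" for c w
    by (simp add: \<Phi>_def loop_scale_def loop_act_def mult.commute[of _ "tp_const c"]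
        scale_right W.scale_right_distrib)
  ultimately have "Vector_Spaces.linear loop_scale scaleW \<Phi>"
    unfolding Vector_Spaces.linear_iff using loop.vector_space_axioms W by blast
  moreover have "\<Phi> (u \<otimes> a) = \<phi> u a" for u a
  proof -
    have "u = sl2_scale (e_coeff u) sl2_e + sl2_scale (f_coeff u) sl2_f
        + sl2_scale (h_coeff u) sl2_h"
      by (simp add: sl2_elem_defs sl2_op_defs)
    then have "\<phi> u a = scaleW (e_coeff u) (\<phi> sl2_e a) + scaleW (f_coeff u) (\<phi> sl2_f a)
        + scaleW (h_coeff u) (\<phi> sl2_h a)"
      by (metis add_left scale_left)
    then show ?thesis by (simp add: \<Phi>_def tensor_def scale_right)
  qed
  moreover have "\<Psi> = \<Phi>"
    if L: "Vector_Spaces.linear loop_scale scaleW \<Psi>" and E: "\<forall>u a. \<Psi> (u \<otimes> a) = \<phi> u a" for \<Psi>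
  proof
    fix w
    have "\<Psi> w = \<Psi> (sl2_e \<otimes> e_coeff w + sl2_f \<otimes> f_coeff w + sl2_h \<otimes> h_coeff w)"
      using dec[of w] by simp
    also have "\<dots> = \<Phi> w"
      by (simp only: P.linear_add[OF L] E \<Phi>_def)
    finally show "\<Psi> w = \<Phi> w" .
  qed
  ultimately show ?thesis by blast
qed


section \<open>The Onsager Lie algebra\<close>

definition lie_subalgebra :: "'a::field loop set \<Rightarrow> bool" where
  "lie_subalgebra S \<longleftrightarrow> loop.subspace S \<and> (\<forall>u\<in>S. \<forall>v\<in>S. lie_bracket u v \<in> S)"

definition ons_A :: "'a::field loop" where
  "ons_A = sl2_x \<otimes> 1"

definition ons_B :: "'a::field loop" where
  "ons_B = sl2_y \<otimes> tp_t + sl2_z \<otimes> (tp_t - 1)"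

definition onsager :: "'a::field loop set" where
  "onsager = lie_subalgebra hull {ons_A, ons_B}"

lemma lie_subalgebra_onsager: "lie_subalgebra onsager"
  unfolding onsager_def
  by (rule hull_in)
    (auto simp: lie_subalgebra_def intro!: loop.subspace_Inter)

lemma dolan_grady:
  "lie_bracket ons_A (lie_bracket ons_A (lie_bracket ons_A ons_B))
     = 4 *\<^sub>L lie_bracket ons_A (ons_B :: 'a::field loop)"
  "lie_bracket ons_B (lie_bracket ons_B (lie_bracket ons_B ons_A))
     = 4 *\<^sub>L lie_bracket ons_B (ons_A :: 'a::field loop)"
proof -
  have 2: "tp_const 2 = (2 :: 'a three_point)"
    using tp_const_simps(3)[of "1::'a" 1] by (simp add: tp_const_simps)
  have 4: "tp_const 4 = (4 :: 'a three_point)"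
    using tp_const_simps(3)[of "2::'a" 2] by (simp add: 2)
  note defs = ons_A_def ons_B_def loop_scale_def loop_act_def tensor_def sl2_op_defs
    sl2_elem_defs tp_const_simps 2 4
  show "lie_bracket ons_A (lie_bracket ons_A (lie_bracket ons_A ons_B))
     = 4 *\<^sub>L lie_bracket ons_A (ons_B :: 'a loop)"
    by (simp add: defs algebra_simps)
  show "lie_bracket ons_B (lie_bracket ons_B (lie_bracket ons_B ons_A))
     = 4 *\<^sub>L lie_bracket ons_B (ons_A :: 'a loop)"
    by (simp add: defs algebra_simps)
qed


section \<open>The basis [3012]\<close>

definition A_ud :: "nat \<Rightarrow> 'a::field loop" where
  "A_ud i = sl2_x \<otimes> (- tp_t) ^ i"

definition B_ud :: "nat \<Rightarrow> 'a::field loop" where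
  "B_ud i = (- (sl2_y \<otimes> tp_t) - sl2_z \<otimes> (tp_t - 1)) \<cdot> (- tp_t) ^ i"

text \<open>Only meaningful for \<open>i \<ge> 1\<close>.\<close>

definition psi_ud :: "nat \<Rightarrow> 'a::field loop" where
  "psi_ud i = (sl2_x \<otimes> 1 - sl2_z \<otimes> (tp_t - 1)) \<cdot> (- tp_t) ^ (i - 1)"

text \<open>The family \<open>A 0, B 0, psi 1, A 1, B 1, psi 2, \<dots>\<close>, in this order.\<close>

definition basis_3012 :: "nat \<Rightarrow> 'a::field loop" where
  "basis_3012 n =
     (if n mod 3 = 0 then A_ud (n div 3)
      else if n mod 3 = 1 then B_ud (n div 3)
      else psi_ud (n div 3 + 1))"

text \<open>
  The sequence computed in that order by the recursion: positions \<open>3i - 1\<close>, \<open>3i\<close> and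
  \<open>3i + 1\<close> hold \<open>psi i\<close>, \<open>A i\<close> and \<open>B i\<close>.
\<close>

fun recursive_3012 :: "nat \<Rightarrow> 'a::field loop" where
  "recursive_3012 0 = ons_A"
| "recursive_3012 (Suc 0) = - ons_B"
| "recursive_3012 (Suc (Suc n)) =
     (if n mod 3 = 0 then
        (1/2) *\<^sub>L recursive_3012 n + (1/2) *\<^sub>L recursive_3012 (Suc n)
          + (1/4) *\<^sub>L lie_bracket (recursive_3012 n) ons_B
      else if n mod 3 = 1 then
        (1/2) *\<^sub>L lie_bracket (recursive_3012 (Suc n)) ons_A - recursive_3012 (Suc n)
      else
        - ((1/2) *\<^sub>L lie_bracket ons_B (recursive_3012 n)) - recursive_3012 n)"

text \<open>A sequence of pairwise distinct vectors that are a vector space basis of \<open>V\<close>.\<close>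

definition is_basis_of :: "(nat \<Rightarrow> 'a::field loop) \<Rightarrow> 'a loop set \<Rightarrow> bool" where
  "is_basis_of b V \<longleftrightarrow> inj b \<and> loop.independent (range b) \<and> loop.span (range b) = V"

end

(*
  In the coordinates e, f, h over F[t, 1/t, 1/(t-1)] the three families are (2, 0, -1), (0, 2t, 1)
  and (2, 0, -t) times powers of -t, and the recursion is a direct calculation. Since the bracket is
  bilinear over that algebra, the same calculation expresses every bracket of two family members
  by members of the family, so their span is a Lie subalgebra; by the recursion it is contained
  in every Lie subalgebra containing A and B. A linear relation gives power sums P0, P1, P2 with
  P0 + P2 = 0, t P1 = 0 and - P0 + P1 - t P2 = 0; as t and t - 1 are units, all vanish, and the
  powers of t are linearly independent.
*)

theory Submission
  imports Defs
begin

section \<open>Independence of sequences and of powers of t\<close>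

text \<open>A repeated vector is itself a nontrivial relation, with coefficients 1 and -1, so one
  condition on initial segments yields both conclusions. A finite subset of the range is pulled back
  along the injective \<open>b\<close> and its coefficients are padded by zero.\<close>

lemma (in vector_space) inj_independent_sequenceI:
  fixes b :: "nat \<Rightarrow> 'b"
  assumes *: "\<And>N c k. (\<Sum>k<N. scale (c k) (b k)) = 0 \<Longrightarrow> k < N \<Longrightarrow> c k = 0"
  shows "inj b" and "independent (range b)"
proof -
  have "b i \<noteq> b j" if "i < j" for i j
  proof
    assume eq: "b i = b j"
    let ?c = "\<lambda>k. if k = i then 1 else if k = j then - 1 else 0 :: 'a"
    have "(\<Sum>k<Suc j. scale (?c k) (b k)) = (\<Sum>k\<in>{i, j}. scale (?c k) (b k))"
      using that by (intro sum.mono_neutral_right) auto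
    also have "\<dots> = 0"
      using that eq by simp
    finally have "?c i = 0"
      by (rule *) (use that in simp)
    then show False by simp
  qed
  then show "inj b"
    by (metis injI linorder_neqE_nat)
  show "independent (range b)"
    unfolding independent_explicit_finite_subsets
  proof (intro allI impI ballI)
    fix S u v
    assume S: "S \<subseteq> range b" "finite S" and 0: "(\<Sum>v\<in>S. scale (u v) v) = 0" and v: "v \<in> S"
    define K where "K = b -` S"
    have K: "finite K" "b ` K = S" "inj_on b K"
      using S \<open>inj b\<close> by (auto simp: K_def finite_vimageI intro: inj_on_subset)
    obtain N where N: "K \<subseteq> {..<N}"
      using K(1) finite_nat_iff_bounded by blast
    let ?c = "\<lambda>k. if k \<in> K then u (b k) else 0"
    have "(\<Sum>k<N. scale (?c k) (b k)) = (\<Sum>k\<in>K. scale (?c k) (b k))"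
      using N by (intro sum.mono_neutral_right) auto
    also have "\<dots> = (\<Sum>k\<in>K. scale (u (b k)) (b k))"
      by (rule sum.cong) auto
    also have "\<dots> = (\<Sum>v\<in>S. scale (u v) v)"
      using K by (metis (mono_tags, lifting) sum.reindex_cong)
    also have "\<dots> = 0" by (rule 0)
    finally have sum0: "(\<Sum>k<N. scale (?c k) (b k)) = 0" .
    obtain k where k: "k \<in> K" "v = b k"
      using v K(2) by blast
    then have "?c k = 0"
      using N by (intro *[OF sum0]) auto
    then show "u v = 0"
      using k by simp
  qed
qed

section \<open>Polynomials in t as elements of the coefficient ring\<close>

definition tp_of_poly :: "'a::field poly \<Rightarrow> 'a three_point" where
  "tp_of_poly p = Abs_tp (Fract p 1)"

lemma rat_of_tp_of_poly: "rat_of_tp (tp_of_poly p) = Fract p 1"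
  unfolding tp_of_poly_def
  by (rule Abs_tp_inverse) (auto intro!: exI[of _ p] exI[of _ "0 :: nat"])

lemma tp_of_poly_hom:
  "tp_of_poly 0 = 0" "tp_of_poly (p + q) = tp_of_poly p + tp_of_poly q"
  "tp_of_poly (p * q) = tp_of_poly p * tp_of_poly q"
  by (simp_all add: rat_of_tp_of_poly zero_three_point.rep_eq plus_three_point.rep_eq
      times_three_point.rep_eq Zero_fract_def flip: rat_of_tp_inject)

lemma tp_of_poly_eq_0_iff: "tp_of_poly p = 0 \<longleftrightarrow> p = 0"
  by (simp add: rat_of_tp_of_poly zero_three_point.rep_eq Zero_fract_def eq_fract
      flip: rat_of_tp_inject)

text \<open>The sign goes into the coefficient because the three families are built from powers of
  \<open>- tp_t\<close>, while monomials are powers of t.\<close>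

lemma tp_of_poly_monom:
  "tp_of_poly (monom (c * (- 1) ^ i) i) = tp_const c * (- tp_t) ^ i"
proof (induction i)
  case 0
  show ?case
    by (simp add: rat_of_tp_of_poly tp_const.rep_eq monom_0 flip: rat_of_tp_inject)
next
  case (Suc i)
  have t: "tp_of_poly [:0, - 1:] = (- tp_t :: 'a three_point)"
    by (simp add: rat_of_tp_of_poly uminus_three_point.rep_eq tp_t.rep_eq flip: rat_of_tp_inject)
  have "monom (c * (- 1) ^ Suc i) (Suc i) = monom (c * (- 1) ^ i) i * [:0, - 1:]"
    by (simp add: monom_Suc mult.commute minus_monom)
  then show ?case
    by (simp only: tp_of_poly_hom Suc t power_Suc ac_simps)
qed

text \<open>The relation is the image of a polynomial under the injective map
  \<open>tp_of_poly\<close>; comparing coefficients leaves \<open>a i\<close> times a sign.\<close>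

lemma powers_of_t_independent:
  fixes a :: "nat \<Rightarrow> 'a::field"
  assumes "(\<Sum>i<n. tp_const (a i) * (- tp_t) ^ i) = 0" and "i < n"
  shows "a i = 0"
proof -
  have "tp_of_poly (\<Sum>i<n. monom (a i * (- 1) ^ i) i) = (\<Sum>i<n. tp_const (a i) * (- tp_t) ^ i)"
    by (induction n) (simp_all add: tp_of_poly_hom tp_of_poly_monom)
  then have "(\<Sum>i<n. monom (a i * (- 1) ^ i) i) = 0"
    by (simp only: assms(1) tp_of_poly_eq_0_iff)
  then have "coeff (\<Sum>i<n. monom (a i * (- 1) ^ i) i) i = 0"
    by simp
  then show ?thesis
    using assms(2) by (simp add: coeff_sum)
qed

lemma tp_const_of_nat: "tp_const (of_nat n) = of_nat n"
  by (induction n) (simp_all add: tp_const_simps)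

lemma tp_const_numeral: "tp_const (numeral n) = numeral n"
  using tp_const_of_nat[of "numeral n"] by simp

text \<open>Multiply by the inverse of \<open>u\<close>. This is the form of cancellation used below
  for the invertible factors 2, t and t - 1.\<close>

lemma tp_unit_cancel: "u dvd 1 \<Longrightarrow> u * w = 0 \<Longrightarrow> w = (0 :: 'a::comm_ring_1)"
  by (metis dvdE mult.commute mult.left_commute mult_1 mult_zero_right)


section \<open>The recursion and the brackets\<close>

lemma ons_eq:
  "ons_A = SL2 2 0 (- 1)"
  "ons_B = SL2 0 (- 2 * tp_t) (- 1)"
  by (simp_all add: ons_A_def ons_B_def tensor_def sl2_op_defs sl2_elem_defs tp_const_simps
      tp_const_numeral)

text \<open>With \<open>psi_ud\<close> taken at \<open>Suc i\<close>, all three families carry the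
  exponent \<open>i\<close> and no truncated subtraction remains.\<close>

lemma basis_elem_eq:
  "A_ud i = SL2 (2 * (- tp_t) ^ i) 0 (- ((- tp_t) ^ i))"
  "B_ud i = SL2 0 (2 * tp_t * (- tp_t) ^ i) ((- tp_t) ^ i)"
  "psi_ud (Suc i) = SL2 (2 * (- tp_t) ^ i) 0 (- tp_t * (- tp_t) ^ i)"
  by (simp_all add: A_ud_def B_ud_def psi_ud_def loop_act_def tensor_def sl2_op_defs sl2_elem_defs
      tp_const_simps tp_const_numeral algebra_simps)

lemma loop_scale_SL2: "c *\<^sub>L SL2 u v w = SL2 (tp_const c * u) (tp_const c * v) (tp_const c * w)"
  by (simp add: loop_scale_def loop_act_def mult.commute)

text \<open>Each family consists of multiples of one fixed vector by powers of -t, so its members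
  commute. The mixed brackets are those of the three leading vectors times
  \<open>(- tp_t) ^ (i + j)\<close>, by bilinearity over the coefficient ring. Both the recursion
  and closure under brackets are read off from this table.\<close>

lemma brackets_3012:
  "lie_bracket (A_ud i) (A_ud j) = 0"
  "lie_bracket (B_ud i) (B_ud j) = 0"
  "lie_bracket (psi_ud (Suc i)) (psi_ud (Suc j)) = 0"
  "lie_bracket (A_ud i) (B_ud j) = 2 *\<^sub>L A_ud (i + j) + 2 *\<^sub>L B_ud (i + j) - 4 *\<^sub>L psi_ud (Suc (i + j))"
  "lie_bracket (psi_ud (Suc i)) (A_ud j) = 2 *\<^sub>L A_ud (Suc (i + j)) + 2 *\<^sub>L psi_ud (Suc (i + j))"
  "lie_bracket (psi_ud (Suc i)) (B_ud j) = - (2 *\<^sub>L B_ud (Suc (i + j)) + 2 *\<^sub>L psi_ud (Suc (i + j)))"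
  by (simp_all add: basis_elem_eq loop_scale_SL2 sl2_op_defs tp_const_numeral algebra_simps power_add)

lemma lie_bracket_commute: "lie_bracket u v = - lie_bracket v u"
  by (simp add: sl2_op_defs algebra_simps)

lemma lie_bracket_minus: "lie_bracket u (- v) = - lie_bracket u v"
  by (simp add: sl2_op_defs algebra_simps)

lemma A_ud_0: "A_ud 0 = ons_A"
  by (simp add: basis_elem_eq ons_eq)

lemma B_ud_0: "B_ud 0 = - ons_B"
  by (simp add: basis_elem_eq ons_eq sl2_op_defs)

lemma ons_B_eq: "ons_B = - B_ud 0"
  by (simp add: B_ud_0)

text \<open>Since A is \<open>A_ud 0\<close> and B is \<open>- B_ud 0\<close>, these are the three
  mixed brackets with second index 0, solved for the newly occurring element; characteristic zero
  permits the divisions by 2 and 4.\<close>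

lemma recursion_3012:
  shows "(psi_ud (Suc i) :: 'a::field_char_0 loop) = (1/2) *\<^sub>L A_ud i + (1/2) *\<^sub>L B_ud i + (1/4) *\<^sub>L lie_bracket (A_ud i) ons_B"
    and "(A_ud (Suc i) :: 'a loop) = (1/2) *\<^sub>L lie_bracket (psi_ud (Suc i)) ons_A - psi_ud (Suc i)"
    and "(B_ud (Suc i) :: 'a loop) = - ((1/2) *\<^sub>L lie_bracket ons_B (psi_ud (Suc i))) - psi_ud (Suc i)"
proof -
  show "(psi_ud (Suc i) :: 'a loop) = (1/2) *\<^sub>L A_ud i + (1/2) *\<^sub>L B_ud i + (1/4) *\<^sub>L lie_bracket (A_ud i) ons_B"
    by (simp add: ons_B_eq lie_bracket_minus brackets_3012 loop.scale_right_distrib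
        loop.scale_right_diff_distrib)
  show "(A_ud (Suc i) :: 'a loop) = (1/2) *\<^sub>L lie_bracket (psi_ud (Suc i)) ons_A - psi_ud (Suc i)"
    by (simp add: brackets_3012 loop.scale_right_distrib flip: A_ud_0)
  show "(B_ud (Suc i) :: 'a loop) = - ((1/2) *\<^sub>L lie_bracket ons_B (psi_ud (Suc i))) - psi_ud (Suc i)"
    by (simp add: ons_B_eq lie_bracket_commute[of "- _"] lie_bracket_minus brackets_3012
        loop.scale_right_distrib loop.scale_right_diff_distrib)
qed

section \<open>The interleaved sequence and its recursion\<close>

lemma basis_3012_simps:
  "basis_3012 (3 * i) = A_ud i"
  "basis_3012 (3 * i + 1) = B_ud i"
  "basis_3012 (3 * i + 2) = psi_ud (Suc i)"
proof -
  have "(3 * i + 1) mod 3 = 1" "(3 * i + 1) div 3 = i" "(3 * i + 2) mod 3 = 2" "(3 * i + 2) div 3 = i"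
    by presburger+
  then show "basis_3012 (3 * i) = A_ud i" "basis_3012 (3 * i + 1) = B_ud i"
    "basis_3012 (3 * i + 2) = psi_ud (Suc i)"
    by (simp_all only: basis_3012_def) simp_all
qed

lemma mod_3_cases:
  fixes n :: nat
  obtains i where "n = 3 * i" | i where "n = 3 * i + 1" | i where "n = 3 * i + 2"
proof -
  have "n = 3 * (n div 3) \<or> n = 3 * (n div 3) + 1 \<or> n = 3 * (n div 3) + 2"
    by presburger
  then show ?thesis using that by blast
qed

lemma basis_3012_eq_recursive:
  "(basis_3012 n :: 'a::field_char_0 loop) = recursive_3012 n"
proof (induction n rule: recursive_3012.induct)
  case 1
  show ?case using basis_3012_simps(1)[of 0] by (simp add: A_ud_0)
next
  case 2
  show ?case using basis_3012_simps(2)[of 0] by (simp add: B_ud_0)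
next
  case (3 n)
  show ?case
  proof (cases n rule: mod_3_cases)
    case (1 i)
    have idx: "n = 3 * i" "Suc n = 3 * i + 1" "Suc (Suc n) = 3 * i + 2" "n mod 3 = 0"
      using 1 by presburger+
    have "recursive_3012 n = (A_ud i :: 'a loop)" "recursive_3012 (Suc n) = (B_ud i :: 'a loop)"
      using 3 idx by (metis basis_3012_simps)+
    moreover have "basis_3012 (Suc (Suc n)) = (psi_ud (Suc i) :: 'a loop)"
      using idx by (metis basis_3012_simps)
    ultimately show ?thesis
      using idx(4) by (simp add: recursion_3012(1))
  next
    case (2 i)
    have idx: "Suc n = 3 * i + 2" "Suc (Suc n) = 3 * Suc i" "n mod 3 = 1"
      using 2 by presburger+
    have "recursive_3012 (Suc n) = (psi_ud (Suc i) :: 'a loop)"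
      using 3 idx by (metis basis_3012_simps zero_neq_one)
    moreover have "basis_3012 (Suc (Suc n)) = (A_ud (Suc i) :: 'a loop)"
      using idx by (metis basis_3012_simps)
    ultimately show ?thesis
      using idx(3) by (simp add: recursion_3012(2))
  next
    case (3 i)
    have idx: "n = 3 * i + 2" "Suc (Suc n) = 3 * Suc i + 1" "n mod 3 = 2"
      using 3 by presburger+
    \<comment> \<open>The B of index \<open>Suc i\<close> is computed from the psi two positions
      back, skipping the A in between, so the induction hypothesis is taken at
      \<open>n\<close>.\<close>
    have "recursive_3012 n = (basis_3012 n :: 'a loop)"
      using "3.IH" idx(3) by simp
    then have "recursive_3012 n = (psi_ud (Suc i) :: 'a loop)"
      using idx(1) by (metis basis_3012_simps(3))
    moreover have "basis_3012 (Suc (Suc n)) = (B_ud (Suc i) :: 'a loop)"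
      using idx by (metis basis_3012_simps)
    ultimately show ?thesis
      using idx(3) by (simp add: recursion_3012(3))
  qed
qed


section \<open>The basis property\<close>

lemma sum_by_threes:
  fixes f :: "nat \<Rightarrow> 'b::comm_monoid_add"
  shows "(\<Sum>k<3 * n. f k) = (\<Sum>i<n. f (3 * i) + f (3 * i + 1) + f (3 * i + 2))"
  by (induction n) (simp_all add: numeral_3_eq_3 add_ac)

lemma sl2_sum:
  "(\<Sum>i\<in>I. SL2 (a i) (b i) (c i)) = SL2 (\<Sum>i\<in>I. a i) (\<Sum>i\<in>I. b i) (\<Sum>i\<in>I. c i)"
  by (induction I rule: infinite_finite_induct) (simp_all add: zero_sl2_def plus_sl2_def)

lemma basis_3012_relation:
  fixes c :: "nat \<Rightarrow> 'a::field_char_0"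
  assumes "(\<Sum>k<N. c k *\<^sub>L basis_3012 k) = 0" and "k < N"
  shows "c k = 0"
proof -
  \<comment> \<open>Padding by zeros lets the sum run to \<open>3 * N\<close>, that is, over
    \<open>N\<close> complete triples.\<close>
  define d where "d k = (if k < N then c k else 0)" for k
  \<comment> \<open>\<open>P 0\<close>, \<open>P 1\<close> and \<open>P 2\<close> are the total
    coefficients, in the coefficient ring, of the leading vectors of A, B and psi.\<close>
  define P where "P j = (\<Sum>i<N. tp_const (d (3 * i + j)) * (- tp_t) ^ i)" for j
  have "(\<Sum>k<3 * N. d k *\<^sub>L basis_3012 k) = (\<Sum>k<N. d k *\<^sub>L basis_3012 k)"
    by (rule sum.mono_neutral_right) (auto simp: d_def)
  also have "\<dots> = 0"
    using assms(1) by (simp add: d_def)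
  finally have "0 = (\<Sum>i<N. d (3 * i) *\<^sub>L A_ud i + d (3 * i + 1) *\<^sub>L B_ud i + d (3 * i + 2) *\<^sub>L psi_ud (Suc i))"
    unfolding sum_by_threes by (simp only: basis_3012_simps)
  also have "\<dots> = SL2 (2 * (P 0 + P 2)) (2 * (tp_t * P 1)) (- P 0 + P 1 - tp_t * P 2)"
    by (simp add: basis_elem_eq loop_scale_SL2 plus_sl2_def sl2_sum P_def sum_distrib_left
        sum.distrib sum_subtractf sum_negf algebra_simps)
  finally have eqs: "2 * (P 0 + P 2) = 0" "2 * (tp_t * P 1) = 0" "- P 0 + P 1 - tp_t * P 2 = 0"
    by (simp_all add: zero_sl2_def)
  \<comment> \<open>The inverse of 2 is the constant 1/2, which exists in characteristic
    zero.\<close>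
  have two: "(2 :: 'a three_point) dvd 1"
    using tp_const_simps(4)[of "2 :: 'a" "1 / 2"] by (simp add: tp_const_simps tp_const_numeral) (metis dvdI)
  have P1: "P 1 = 0"
    using eqs(2) tp_unit_cancel[OF two] tp_unit_cancel[OF tp_t_dvd_1] by blast
  have P0: "P 0 = - P 2"
    using eqs(1) tp_unit_cancel[OF two] by (simp add: eq_neg_iff_add_eq_0)
  \<comment> \<open>Substituting \<open>P 0 = - P 2\<close> and \<open>P 1 = 0\<close> in the third
    equation leaves this up to sign.\<close>
  have "(tp_t - 1) * P 2 = 0"
    using eqs(3) P0 P1 by (simp add: algebra_simps)
  then have P2: "P 2 = 0"
    by (rule tp_unit_cancel[OF tp_t_minus_1_dvd_1])
  have *: "d (3 * i + j) = 0" if "j \<in> {0, 1, 2}" "i < N" for i j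
  proof (rule powers_of_t_independent[where n = N and a = "\<lambda>i. d (3 * i + j)"])
    show "(\<Sum>i<N. tp_const (d (3 * i + j)) * (- tp_t) ^ i) = 0"
      using that P0 P1 P2 by (auto simp flip: P_def)
  qed (use that in simp)
  have "k = 3 * (k div 3) + k mod 3" "k mod 3 \<in> {0, 1, 2}" "k div 3 < N"
    using assms(2) by auto
  then have "d k = 0"
    using * by metis
  then show ?thesis
    using assms(2) by (simp add: d_def)
qed

section \<open>The span as a Lie subalgebra, and its equality with the Onsager algebra\<close>

lemma lie_bracket_span_closed:
  assumes S: "\<And>u v. u \<in> S \<Longrightarrow> v \<in> S \<Longrightarrow> lie_bracket u v \<in> loop.span S"
    and "u \<in> loop.span S" "v \<in> loop.span S"
  shows "lie_bracket u v \<in> loop.span S"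
proof -
  have scale: "c *\<^sub>L w = sl2_scale (tp_const c) w" for c and w :: "'a loop"
    by (simp add: loop_scale_def loop_act_def sl2_scale_def mult.commute)
  have linear: "lie_bracket (c *\<^sub>L x + y) w = c *\<^sub>L lie_bracket x w + lie_bracket y w"
    "lie_bracket w (c *\<^sub>L x + y) = c *\<^sub>L lie_bracket w x + lie_bracket w y" for c and x y w :: "'a loop"
    by (simp_all add: scale lie_bracket_lie_algebra)
  have zero: "lie_bracket w 0 = 0" "lie_bracket 0 w = 0" for w :: "'a loop"
    by (simp_all add: sl2_op_defs)
  \<comment> \<open>Bilinearity is used one argument at a time: first \<open>u\<close> runs through
    the span against a fixed generator, then the second argument does.\<close>
  have 1: "lie_bracket u w \<in> loop.span S" if "w \<in> S" for w
    using assms(2)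
  proof (induction u rule: loop.span_induct_alt)
    case base
    show ?case by (simp add: zero loop.span_zero)
  next
    case (step c x y)
    then show ?case
      using S[OF step(1) that]
      by (simp add: linear loop.span_add loop.span_scale)
  qed
  show ?thesis
    using assms(3)
  proof (induction v rule: loop.span_induct_alt)
    case base
    show ?case by (simp add: zero loop.span_zero)
  next
    case (step c x y)
    then show ?case
      using 1[OF step(1)]
      by (simp add: linear loop.span_add loop.span_scale)
  qed
qed

lemma ud_in_range:
  "A_ud i \<in> range basis_3012" "B_ud i \<in> range basis_3012" "psi_ud (Suc i) \<in> range basis_3012"
  using basis_3012_simps[of i] by (metis rangeI)+

lemma range_basis_3012E:
  assumes "u \<in> range basis_3012"
  obtains i where "u = A_ud i" | i where "u = B_ud i" | i where "u = psi_ud (Suc i)"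
  using assms by (metis basis_3012_simps mod_3_cases rangeE)

lemma bracket_in_span_basis_3012:
  assumes "u \<in> range basis_3012" "v \<in> range basis_3012"
  shows "lie_bracket u v \<in> loop.span (range (basis_3012 :: nat \<Rightarrow> 'a::field loop))"
proof -
  note base = ud_in_range[THEN loop.span_base]
  note closed = loop.span_add loop.span_diff loop.span_neg loop.span_scale loop.span_zero
  have *: "lie_bracket (A_ud i) (B_ud j) \<in> loop.span (range (basis_3012 :: nat \<Rightarrow> 'a loop))"
    "lie_bracket (psi_ud (Suc i)) (A_ud j) \<in> loop.span (range (basis_3012 :: nat \<Rightarrow> 'a loop))"
    "lie_bracket (psi_ud (Suc i)) (B_ud j) \<in> loop.span (range (basis_3012 :: nat \<Rightarrow> 'a loop))" for i j
    unfolding brackets_3012 by (intro closed base)+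
  \<comment> \<open>The table lists one order of each mixed pair; antisymmetry of the bracket
    supplies the other.\<close>
  have "lie_bracket v u \<in> loop.span (range (basis_3012 :: nat \<Rightarrow> 'a loop))
    \<Longrightarrow> lie_bracket u v \<in> loop.span (range (basis_3012 :: nat \<Rightarrow> 'a loop))" for u v
    by (subst lie_bracket_commute) (rule loop.span_neg)
  note sw = this[OF *(1)] this[OF *(2)] this[OF *(3)]
  show ?thesis
    using assms(1)
  proof (cases rule: range_basis_3012E)
    case 1
    show ?thesis
      using assms(2) by (cases rule: range_basis_3012E) (simp_all add: 1 * sw brackets_3012(1-3) loop.span_zero)
  next
    case 2
    show ?thesis
      using assms(2) by (cases rule: range_basis_3012E) (simp_all add: 2 * sw brackets_3012(1-3) loop.span_zero)
  next
    case 3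
    show ?thesis
      using assms(2) by (cases rule: range_basis_3012E) (simp_all add: 3 * sw brackets_3012(1-3) loop.span_zero)
  qed
qed

text \<open>The recursion starts from A and -B and uses only linear combinations and brackets with A
  or B, none of which leaves a Lie subalgebra.\<close>

lemma recursive_3012_in_onsager: "recursive_3012 n \<in> onsager"
proof -
  have sub: "loop.subspace (onsager :: 'a loop set)"
    and br: "\<And>u v :: 'a loop. u \<in> onsager \<Longrightarrow> v \<in> onsager \<Longrightarrow> lie_bracket u v \<in> onsager"
    using lie_subalgebra_onsager by (auto simp: lie_subalgebra_def)
  have gen: "ons_A \<in> (onsager :: 'a loop set)" "ons_B \<in> (onsager :: 'a loop set)"
    unfolding onsager_def by (auto intro: hull_inc)
  note closed = loop.subspace_add[OF sub] loop.subspace_diff[OF sub] loop.subspace_neg[OF sub]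
    loop.subspace_scale[OF sub] br gen
  show ?thesis
    by (induction n rule: recursive_3012.induct) (auto intro!: closed)
qed

text \<open>One inclusion comes from the recursion. For the other, the span is a Lie subalgebra
  containing \<open>A_ud 0\<close> and \<open>B_ud 0\<close>, hence both generators, and the hull is
  the least such subalgebra.\<close>

lemma span_basis_3012:
  "loop.span (range (basis_3012 :: nat \<Rightarrow> 'a::field_char_0 loop)) = onsager"
proof
  have "loop.subspace (onsager :: 'a loop set)"
    using lie_subalgebra_onsager by (auto simp: lie_subalgebra_def)
  then show "loop.span (range (basis_3012 :: nat \<Rightarrow> 'a loop)) \<subseteq> onsager"
    by (intro loop.span_minimal) (auto simp: basis_3012_eq_recursive recursive_3012_in_onsager)
  have "ons_A \<in> loop.span (range (basis_3012 :: nat \<Rightarrow> 'a loop))"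
    by (metis A_ud_0 loop.span_base ud_in_range(1))
  moreover have "ons_B \<in> loop.span (range (basis_3012 :: nat \<Rightarrow> 'a loop))"
    by (metis ons_B_eq loop.span_base loop.span_neg ud_in_range(2))
  moreover have "lie_subalgebra (loop.span (range (basis_3012 :: nat \<Rightarrow> 'a loop)))"
    unfolding lie_subalgebra_def
    using lie_bracket_span_closed[OF bracket_in_span_basis_3012] by auto
  ultimately show "onsager \<subseteq> loop.span (range (basis_3012 :: nat \<Rightarrow> 'a loop))"
    unfolding onsager_def by (intro hull_minimal) auto
qed

theorem corollary9p5:
  shows "is_basis_of (basis_3012 :: nat \<Rightarrow> 'a::field_char_0 loop) onsager
    \<and> (A_ud 0 :: 'a loop) = ons_A
    \<and> (B_ud 0 :: 'a loop) = - ons_B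
    \<and> (\<forall>i\<ge>1.
        (psi_ud i :: 'a loop) =
          (1/2) *\<^sub>L A_ud (i - 1) + (1/2) *\<^sub>L B_ud (i - 1)
            + (1/4) *\<^sub>L lie_bracket (A_ud (i - 1)) ons_B
        \<and> (A_ud i :: 'a loop) = (1/2) *\<^sub>L lie_bracket (psi_ud i) ons_A - psi_ud i
        \<and> (B_ud i :: 'a loop) = - ((1/2) *\<^sub>L lie_bracket ons_B (psi_ud i)) - psi_ud i)
    \<and> (basis_3012 :: nat \<Rightarrow> 'a loop) = recursive_3012"
proof (intro conjI allI impI)
  show "is_basis_of (basis_3012 :: nat \<Rightarrow> 'a loop) onsager"
    unfolding is_basis_of_def
    using loop.inj_independent_sequenceI[of basis_3012] basis_3012_relation span_basis_3012 by blast
  show "(basis_3012 :: nat \<Rightarrow> 'a loop) = recursive_3012"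
    by (rule ext) (rule basis_3012_eq_recursive)
  fix i :: nat
  assume "i \<ge> 1"
  \<comment> \<open>With \<open>i = Suc j\<close> the difference \<open>i - 1\<close> is the genuine
    predecessor \<open>j\<close>, which matches the form of the recursion lemma.\<close>
  then obtain j where i: "i = Suc j"
    by (cases i) auto
  show "(psi_ud i :: 'a loop) = (1/2) *\<^sub>L A_ud (i - 1) + (1/2) *\<^sub>L B_ud (i - 1)
      + (1/4) *\<^sub>L lie_bracket (A_ud (i - 1)) ons_B"
    by (simp add: i recursion_3012(1))
  show "(A_ud i :: 'a loop) = (1/2) *\<^sub>L lie_bracket (psi_ud i) ons_A - psi_ud i"
    unfolding i by (rule recursion_3012(2))
  show "(B_ud i :: 'a loop) = - ((1/2) *\<^sub>L lie_bracket ons_B (psi_ud i)) - psi_ud i"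
    unfolding i by (rule recursion_3012(3))
qed (rule A_ud_0 B_ud_0)+

end
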